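(* Let $(u_-,h_-)\in\Omega$, $h_->h_+\ge 1$ and $u_+=u^D(h_+)$. Put $v_\pm=v(u_\pm,h_\pm)$. If for every $u\in(u_+,u_-)$ the chord condition $$\frac{v_+-v_-}{u_+-u_-}>\frac{v(u,h_-)-v_-}{u-u_-}$$ holds, then there is a shock wave connecting $(u_-,h_-)$ with $(u_+,h_+)$.
   Context: Setting. $u\in[1,\infty)$ is the spacing between vehicles, $h\in[1,\infty)$ a hysteresis parameter. Given are smooth functions: the acceleration curve $v^A:[u_0^A,\infty)\to[0,\infty)$ with $u_0^A>1$ and $v^A(u_0^A)=0$; the deceleration curve $v^D:[1,\infty)\to[0,\infty)$ with $v^D(1)=0$; strictly increasing functions $u^D:[1,\infty)\to[1,\infty)$ (a bijection) and $u^A:[1,\infty)\to[u_0^A,\infty)$, with inverse functions $h^D$ and $h^A$ (the latter defined on the range of $u^A$); and scanning curves $v^S(u,h)$ defined on $$\Omega=\{(u,h)\in[1,\infty)\times[1,\infty): u^D(h)\le u\le u^A(h)\},$$ with $v^S(u^A(h),h)=v^A(u^A(h))$ and $v^S(u^D(h),h)=v^D(u^D(h))$. The curves $v^A$ and $v^D$ meet at exactly one point $u_c$, with $v^A<v^D$ for $u<u_c$ (congested zone) and $v^A>v^D$ for $u>u_c$ (free zone), and $h_c:=h^A(u_c)=h^D(u_c)$. Standing assumption (H): $v^A_u>0$, $v^D_u>0$, $v^S_u>0$; $v^S_h>0$ for $h<h_c$ and $v^S_h<0$ for $h>h_c$; $u^A(h)\ge u^D(h)$ with equality if and only if $h=h_c$;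 and $v^A_{uu}<0$, $v^D_{uu}<0$, $v^S_{uu}<0$ (the last in $\Omega$). The velocity $v(u,h)$ on $[1,\infty)\times[1,\infty)$ is $$v(u,h)=\begin{cases}v^D(u)& u\le u^D(h),\\ v^S(u,h)& u^D(h)<u<u^A(h),\\ v^A(u)& u\ge u^A(h).\end{cases}$$ Shock wave connecting $(u_-,h_-)$ with $(u_+,h_+)$, $u_-\ne u_+$: with $v_\pm=v(u_\pm,h_\pm)$ and $s=-\frac{v_+-v_-}{u_+-u_-}$, it is the function equal to $(u_-,h_-)$ for $x<st$ and $(u_+,h_+)$ for $x>st$, required to have a viscous profile, i.e. a continuous pair $(u,h):\mathbb{R}\to[1,\infty)\times[1,\infty)$ (with $h$ locally Lipschitz and the second equation holding almost everywhere) such that $$u'=-s(u-u_\pm)-(v(u,h)-v_\pm),\quad s h'=s\chi(A)(h^A(u))'+s\chi(D)(h^D(u))',\quad (u,h)(\pm\infty)=(u_\pm,h_\pm),\ (u',h')(\pm\infty)=(0,0),$$ where $'=d/d\xi$, $A=\{su'<0,\ u=u^A(h)\}$, $D=\{su'>0,\ u=u^D(h)\}$, and $\chi(E)=1$ if $E$ is true, $0$ otherwise. *)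

theory Defs
  imports "HOL-Analysis.Analysis"
begin

section \<open>Smoothness up to the boundary\<close>

text \<open>
  The curves live on half-lines and on a closed planar region, so derivatives are taken within
  the domain (one-sided at an endpoint of an interval). On all sets used below (nondegenerate
  intervals, and \<open>\<Omega>\<close> without its pinch point) the derivative within the set is unique.
\<close>

definition deriv_dir :: "'a::euclidean_space set \<Rightarrow> 'a \<Rightarrow> ('a \<Rightarrow> real) \<Rightarrow> 'a \<Rightarrow> real" where
  "deriv_dir S b f x = frechet_derivative f (at x within S) b"

primrec Ck_on :: "nat \<Rightarrow> 'a::euclidean_space set \<Rightarrow> ('a \<Rightarrow> real) \<Rightarrow> bool" where
  "Ck_on 0 S f \<longleftrightarrow> continuous_on S f"
| "Ck_on (Suc k) S f \<longleftrightarrow> f differentiable_on S \<and> (\<forall>b\<in>Basis. Ck_on k S (deriv_dir S b f))"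

definition smooth_on :: "'a::euclidean_space set \<Rightarrow> ('a \<Rightarrow> real) \<Rightarrow> bool" where
  "smooth_on S f \<longleftrightarrow> (\<forall>k. Ck_on k S f)"

section \<open>The hysteretic velocity\<close>

definition Omega :: "(real \<Rightarrow> real) \<Rightarrow> (real \<Rightarrow> real) \<Rightarrow> (real \<times> real) set" where
  "Omega uA uD = {(u, h). 1 \<le> u \<and> 1 \<le> h \<and> uD h \<le> u \<and> u \<le> uA h}"

definition velocity ::
  "(real \<Rightarrow> real) \<Rightarrow> (real \<Rightarrow> real) \<Rightarrow> (real \<Rightarrow> real \<Rightarrow> real) \<Rightarrow> (real \<Rightarrow> real) \<Rightarrow> (real \<Rightarrow> real)
    \<Rightarrow> real \<Rightarrow> real \<Rightarrow> real" where
  "velocity vA vD vS uA uD u h =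
     (if u \<le> uD h then vD u else if u < uA h then vS u h else vA u)"

abbreviation inv_curve :: "(real \<Rightarrow> real) \<Rightarrow> real \<Rightarrow> real" where
  "inv_curve f \<equiv> inv_into {1..} f"

text \<open>
  At \<open>(uc, hc)\<close> the region \<open>\<Omega>\<close> is pinched: its slice at \<open>h = hc\<close> is the single point \<open>uc\<close>, and
  the partial derivatives of \<open>vS\<close> have no meaning there. Hence \<open>vS\<close> is required to be smooth,
  with derivatives up to the boundary, on \<open>\<Omega>\<close> without that point, and continuous on all of \<open>\<Omega>\<close>.
\<close>

locale hysteresis_model =
  fixes vA vD :: "real \<Rightarrow> real" and vS :: "real \<Rightarrow> real \<Rightarrow> real"
    and uA uD :: "real \<Rightarrow> real" and u0A uc hc :: real
  assumes u0A: "u0A > 1"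
    and vA_maps: "vA \<in> {u0A..} \<rightarrow> {0..}" and vA_u0A: "vA u0A = 0"
    and vA_smooth: "smooth_on {u0A..} vA"
    and vD_maps: "vD \<in> {1..} \<rightarrow> {0..}" and vD_1: "vD 1 = 0"
    and vD_smooth: "smooth_on {1..} vD"
    and uD_mono: "strict_mono_on {1..} uD" and uD_bij: "bij_betw uD {1..} {1..}"
    and uA_mono: "strict_mono_on {1..} uA" and uA_maps: "uA \<in> {1..} \<rightarrow> {u0A..}"
    and uD_smooth: "smooth_on {1..} uD" and uA_smooth: "smooth_on {1..} uA"
    and hD_smooth: "smooth_on {1..} (inv_curve uD)"
    and hA_smooth: "smooth_on (uA ` {1..}) (inv_curve uA)"
    and vS_cont: "continuous_on (Omega uA uD) (\<lambda>(u, h). vS u h)"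
    and vS_smooth: "smooth_on (Omega uA uD - {(uc, hc)}) (\<lambda>(u, h). vS u h)"
    and vS_on_A: "\<And>h. h \<ge> 1 \<Longrightarrow> vS (uA h) h = vA (uA h)"
    and vS_on_D: "\<And>h. h \<ge> 1 \<Longrightarrow> vS (uD h) h = vD (uD h)"
    and uc_ge: "uc \<ge> u0A" and meet: "vA uc = vD uc"
    and congested: "\<And>u. u0A \<le> u \<Longrightarrow> u < uc \<Longrightarrow> vA u < vD u"
    and free: "\<And>u. u > uc \<Longrightarrow> vA u > vD u"
    and uc_range: "uc \<in> uA ` {1..}"
    and hc_A: "hc = inv_curve uA uc" and hc_D: "hc = inv_curve uD uc"
    and vA_u: "\<And>u. u \<ge> u0A \<Longrightarrow> deriv_dir {u0A..} 1 vA u > 0"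
    and vD_u: "\<And>u. u \<ge> 1 \<Longrightarrow> deriv_dir {1..} 1 vD u > 0"
    and vS_u: "\<And>p. p \<in> Omega uA uD - {(uc, hc)} \<Longrightarrow>
          deriv_dir (Omega uA uD - {(uc, hc)}) (1, 0) (\<lambda>(u, h). vS u h) p > 0"
    and vS_h_pos: "\<And>p. p \<in> Omega uA uD \<Longrightarrow> snd p < hc \<Longrightarrow>
          deriv_dir (Omega uA uD - {(uc, hc)}) (0, 1) (\<lambda>(u, h). vS u h) p > 0"
    and vS_h_neg: "\<And>p. p \<in> Omega uA uD \<Longrightarrow> snd p > hc \<Longrightarrow>
          deriv_dir (Omega uA uD - {(uc, hc)}) (0, 1) (\<lambda>(u, h). vS u h) p < 0"
    and uA_ge_uD: "\<And>h. h \<ge> 1 \<Longrightarrow> uA h \<ge> uD h"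
    and uA_eq_uD: "\<And>h. h \<ge> 1 \<Longrightarrow> uA h = uD h \<longleftrightarrow> h = hc"
    and vA_uu: "\<And>u. u \<ge> u0A \<Longrightarrow>
          deriv_dir {u0A..} 1 (deriv_dir {u0A..} 1 vA) u < 0"
    and vD_uu: "\<And>u. u \<ge> 1 \<Longrightarrow> deriv_dir {1..} 1 (deriv_dir {1..} 1 vD) u < 0"
    and vS_uu: "\<And>p. p \<in> Omega uA uD - {(uc, hc)} \<Longrightarrow>
          deriv_dir (Omega uA uD - {(uc, hc)}) (1, 0)
            (deriv_dir (Omega uA uD - {(uc, hc)}) (1, 0) (\<lambda>(u, h). vS u h)) p < 0"

section \<open>Viscous profiles and shock waves\<close>

definition shock_speed :: "(real \<Rightarrow> real \<Rightarrow> real) \<Rightarrow> real \<Rightarrow> real \<Rightarrow> real \<Rightarrow> real \<Rightarrow> real" where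
  "shock_speed v um hm up hp = - (v up hp - v um hm) / (up - um)"

text \<open>
  The first equation is required for both choices of the sign in \<open>u\<^sub>\<plusminus>\<close>, \<open>v\<^sub>\<plusminus>\<close>; they agree for
  \<open>s = shock_speed v um hm up hp\<close>. The second one is required almost everywhere, including the
  existence of the derivatives that occur in it with a nonzero coefficient. As \<open>h\<close> need only be
  differentiable almost everywhere, the limits of its derivative are taken along the points where
  \<open>h\<close> is differentiable.
\<close>

definition viscous_profile ::
  "(real \<Rightarrow> real \<Rightarrow> real) \<Rightarrow> (real \<Rightarrow> real) \<Rightarrow> (real \<Rightarrow> real) \<Rightarrow> real
    \<Rightarrow> real \<Rightarrow> real \<Rightarrow> real \<Rightarrow> real \<Rightarrow> (real \<Rightarrow> real) \<Rightarrow> (real \<Rightarrow> real) \<Rightarrow> bool" where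
  "viscous_profile v uA uD s um hm up hp u h \<longleftrightarrow>
     (\<forall>\<xi>. u \<xi> \<ge> 1 \<and> h \<xi> \<ge> 1) \<and>
     continuous_on UNIV u \<and> continuous_on UNIV h \<and>
     (\<forall>\<xi>. \<exists>e>0. \<exists>L. L-lipschitz_on (cball \<xi> e) h) \<and>
     (\<forall>\<xi>. (u has_real_derivative - s * (u \<xi> - um) - (v (u \<xi>) (h \<xi>) - v um hm)) (at \<xi>) \<and>
          (u has_real_derivative - s * (u \<xi> - up) - (v (u \<xi>) (h \<xi>) - v up hp)) (at \<xi>)) \<and>
     (AE \<xi> in lborel.
        let A = (s * deriv u \<xi> < 0 \<and> u \<xi> = uA (h \<xi>));
            D = (s * deriv u \<xi> > 0 \<and> u \<xi> = uD (h \<xi>))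
        in \<exists>h' a d. (h has_real_derivative h') (at \<xi>) \<and>
             (A \<longrightarrow> ((\<lambda>\<eta>. inv_curve uA (u \<eta>)) has_real_derivative a) (at \<xi>)) \<and>
             (D \<longrightarrow> ((\<lambda>\<eta>. inv_curve uD (u \<eta>)) has_real_derivative d) (at \<xi>)) \<and>
             s * h' = s * of_bool A * a + s * of_bool D * d) \<and>
     (u \<longlongrightarrow> um) at_bot \<and> (h \<longlongrightarrow> hm) at_bot \<and>
     (u \<longlongrightarrow> up) at_top \<and> (h \<longlongrightarrow> hp) at_top \<and>
     (deriv u \<longlongrightarrow> 0) at_bot \<and> (deriv u \<longlongrightarrow> 0) at_top \<and>
     (deriv h \<longlongrightarrow> 0) (inf at_bot (principal {\<xi>. h differentiable (at \<xi>)})) \<and>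
     (deriv h \<longlongrightarrow> 0) (inf at_top (principal {\<xi>. h differentiable (at \<xi>)}))"

text \<open>\<open>W t x\<close> is the state at time \<open>t\<close> and position \<open>x\<close>; its values on the line \<open>x = s * t\<close> are
  immaterial.\<close>

definition shock_wave ::
  "(real \<Rightarrow> real \<Rightarrow> real) \<Rightarrow> (real \<Rightarrow> real) \<Rightarrow> (real \<Rightarrow> real)
    \<Rightarrow> real \<Rightarrow> real \<Rightarrow> real \<Rightarrow> real \<Rightarrow> (real \<Rightarrow> real \<Rightarrow> real \<times> real) \<Rightarrow> bool" where
  "shock_wave v uA uD um hm up hp W \<longleftrightarrow>
     um \<ge> 1 \<and> hm \<ge> 1 \<and> up \<ge> 1 \<and> hp \<ge> 1 \<and> um \<noteq> up \<and>
     (let s = shock_speed v um hm up hp in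
        (\<forall>t x. x < s * t \<longrightarrow> W t x = (um, hm)) \<and>
        (\<forall>t x. x > s * t \<longrightarrow> W t x = (up, hp)) \<and>
        (\<exists>u h. viscous_profile v uA uD s um hm up hp u h))"

end

theory Submission
  imports Defs
begin

text \<open>
  The profile descends from \<open>um\<close> to \<open>up < um\<close>. As \<open>v\<close> increases in \<open>u\<close>, the chord from
  \<open>(um, v um hm)\<close> to \<open>(up, v up hp)\<close> has positive slope \<open>c = - s\<close>, so along a decreasing \<open>u\<close>
  one has \<open>s * u' > 0\<close>: only the deceleration branch of the hysteresis can act. Hence \<open>h\<close> stays at
  \<open>hm\<close> until \<open>u\<close> has come down to \<open>uD hm\<close>, and from then on \<open>(u, h)\<close> slides along the curve
  \<open>u = uD h\<close>; that is, \<open>h = min hm (hD u)\<close> with \<open>hD\<close> the inverse of \<open>uD\<close>. This sliding ends in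
  the right state exactly because \<open>up = uD hp\<close>.

  Sliding does not change the velocity: below \<open>uD hm\<close> both \<open>v u hm\<close> and \<open>v u (hD u)\<close> are
  \<open>vD u\<close>. The system therefore decouples, and \<open>u\<close> solves the scalar autonomous equation
  \<open>u' = F u\<close> with \<open>F u = c * (u - um) - (v u hm - v um hm)\<close>. The function \<open>F\<close> vanishes at \<open>up\<close>
  and \<open>um\<close>, and the chord condition says that it is negative in between: the graph of \<open>v\<close> at
  \<open>h = hm\<close> lies above the chord.

  The lemma \<open>decreasing_heteroclinic_orbit\<close> produces the orbit from \<open>um\<close> to \<open>up\<close> by
  quadrature. It requires \<open>- F\<close> to grow at most linearly away from each end. At \<open>um\<close> this is
  monotonicity of the velocity (\<open>velocity_strict_mono\<close>); at \<open>up\<close> it is the Lipschitz continuity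
  of the smooth curve \<open>vD\<close>. The lemma \<open>viscous_profile_along_uD\<close> puts \<open>u\<close> and \<open>h\<close> together;
  the equation for \<open>h\<close> can fail only where \<open>u \<xi> = uD hm\<close>, which happens at most once.
\<close>

section \<open>Connecting orbits of scalar autonomous equations\<close>

text \<open>
  Separation of variables: an antiderivative \<open>T\<close> of \<open>1 / F\<close> is the time at which the orbit passes
  a given point, and the orbit is its inverse. The linear bounds at the two ends make \<open>T\<close> diverge
  there logarithmically, so that the orbit exists for all times.
\<close>

lemma decreasing_heteroclinic_orbit:
  fixes F :: "real \<Rightarrow> real"
  assumes ab: "a < b"
    and cont: "continuous_on {a<..<b} F"
    and neg: "\<And>x. a < x \<Longrightarrow> x < b \<Longrightarrow> F x < 0"
    and L: "L > 0" "\<And>x. a < x \<Longrightarrow> x < b \<Longrightarrow> - F x \<le> L * (x - a)"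
    and M: "M > 0" "\<And>x. a < x \<Longrightarrow> x < b \<Longrightarrow> - F x \<le> M * (b - x)"
  obtains u :: "real \<Rightarrow> real" where
    "\<And>\<xi>. a < u \<xi>" "\<And>\<xi>. u \<xi> < b"
    "\<And>\<xi>. (u has_real_derivative F (u \<xi>)) (at \<xi>)"
    "\<And>\<xi> \<eta>. \<xi> < \<eta> \<Longrightarrow> u \<eta> < u \<xi>"
    "(u \<longlongrightarrow> b) at_bot" "(u \<longlongrightarrow> a) at_top"
proof -
  have "isCont (\<lambda>x. 1 / F x) x" if "a < x" "x < b" for x
    using cont neg[of x] that
    by (intro continuous_divide) (auto simp: continuous_on_eq_continuous_at)
  then have "\<exists>T. \<forall>x::real. ereal a < x \<longrightarrow> x < ereal b \<longrightarrow> (T has_vector_derivative 1 / F x) (at x)"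
    by (intro einterval_antiderivative) (use ab in auto)
  then obtain T where T: "\<And>x. a < x \<Longrightarrow> x < b \<Longrightarrow> (T has_real_derivative 1 / F x) (at x)"
    by (auto simp: has_real_derivative_iff_has_vector_derivative)
  have T_dec: "T y < T x" if "a < x" "x < y" "y < b" for x y
  proof (rule DERIV_neg_imp_decreasing[OF that(2)])
    fix z assume "x \<le> z" "z \<le> y"
    then show "\<exists>d. (T has_real_derivative d) (at z) \<and> d < 0"
      using T[of z] neg[of z] that by (intro exI[of _ "1 / F z"]) auto
  qed
  define m where "m = (a + b) / 2"
  have m: "a < m" "m < b" using ab by (auto simp: m_def)
  have T_ge: "T m + ln (m - a) / L - ln (x - a) / L \<le> T x" if "a < x" "x < m" for x
  proof -
    have "T m + ln (m - a) / L \<le> T x + ln (x - a) / L"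
    proof (rule DERIV_nonpos_imp_nonincreasing[where f = "\<lambda>z. T z + ln (z - a) / L"])
      show "x \<le> m" using that by simp
      fix z assume z: "x \<le> z" "z \<le> m"
      then have zab: "a < z" "z < b" using that m by auto
      have "((\<lambda>z. T z + ln (z - a) / L) has_real_derivative 1 / F z + 1 / (z - a) / L) (at z)"
        using zab L(1) by (auto intro!: derivative_eq_intros T)
      moreover have "1 / F z + 1 / (z - a) / L \<le> 0"
      proof -
        have "1 / (L * (z - a)) \<le> 1 / (- F z)"
          using L(2)[OF zab] neg[OF zab] by (intro frac_le) auto
        then show ?thesis by (simp add: mult.commute)
      qed
      ultimately show "\<exists>d. ((\<lambda>z. T z + ln (z - a) / L) has_real_derivative d) (at z) \<and> d \<le> 0"
        by blast
    qed
    then show ?thesis by simp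
  qed
  have T_le: "T x \<le> T m - ln (b - m) / M + ln (b - x) / M" if "m < x" "x < b" for x
  proof -
    have "T x - ln (b - x) / M \<le> T m - ln (b - m) / M"
    proof (rule DERIV_nonpos_imp_nonincreasing[where f = "\<lambda>z. T z - ln (b - z) / M"])
      show "m \<le> x" using that by simp
      fix z assume z: "m \<le> z" "z \<le> x"
      then have zab: "a < z" "z < b" using that m by auto
      have "((\<lambda>z. T z - ln (b - z) / M) has_real_derivative 1 / F z + 1 / (b - z) / M) (at z)"
        using zab M(1) by (auto intro!: derivative_eq_intros T)
      moreover have "1 / F z + 1 / (b - z) / M \<le> 0"
      proof -
        have "1 / (M * (b - z)) \<le> 1 / (- F z)"
          using M(2)[OF zab] neg[OF zab] by (intro frac_le) auto
        then show ?thesis by (simp add: mult.commute)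
      qed
      ultimately show "\<exists>d. ((\<lambda>z. T z - ln (b - z) / M) has_real_derivative d) (at z) \<and> d \<le> 0"
        by blast
    qed
    then show ?thesis by simp
  qed
  have T_surj: "\<exists>x. a < x \<and> x < b \<and> T x = t" for t
  proof -
    \<comment> \<open>Points so close to the ends that the logarithmic bounds on \<open>T\<close> enclose \<open>t\<close>; the cut-offs
      at half the distance keep them on the proper side of \<open>m\<close>.\<close>
    define x where "x = a + min ((m - a) / 2) (exp (L * (T m + ln (m - a) / L - t)))"
    have "0 < x - a" using m by (auto simp: x_def)
    then have x: "a < x" by simp
    have xm: "x < m" using m by (auto simp: x_def min_def field_simps)
    have "ln (x - a) \<le> ln (exp (L * (T m + ln (m - a) / L - t)))"
      using x by (intro ln_mono) (auto simp: x_def)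
    then have "ln (x - a) / L \<le> T m + ln (m - a) / L - t"
      using L(1) by (simp add: pos_divide_le_eq mult.commute)
    with T_ge[OF x xm] have tx: "t \<le> T x" by simp
    define y where "y = b - min ((b - m) / 2) (exp (M * (t - T m + ln (b - m) / M)))"
    have "0 < b - y" using m by (auto simp: y_def)
    then have y: "y < b" by simp
    have ym: "m < y" using m by (auto simp: y_def min_def field_simps)
    have "ln (b - y) \<le> ln (exp (M * (t - T m + ln (b - m) / M)))"
      using y by (intro ln_mono) (auto simp: y_def)
    then have "ln (b - y) / M \<le> t - T m + ln (b - m) / M"
      using M(1) by (simp add: pos_divide_le_eq mult.commute)
    with T_le[OF ym y] have ty: "T y \<le> t" by simp
    have "\<exists>z\<ge>x. z \<le> y \<and> T z = t"
    proof (rule IVT2)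
      show "T y \<le> t" "t \<le> T x" using ty tx .
      show "\<forall>z. x \<le> z \<and> z \<le> y \<longrightarrow> isCont T z"
        using DERIV_isCont[OF T] x y by auto
    qed (use xm ym in simp)
    then obtain z where "x \<le> z" "z \<le> y" "T z = t" by auto
    then show ?thesis using x y by (intro exI[of _ z]) auto
  qed
  define u where "u t = (SOME x. a < x \<and> x < b \<and> T x = t)" for t
  have u: "a < u t" "u t < b" "T (u t) = t" for t
    using someI_ex[OF T_surj[of t]] by (auto simp: u_def)
  have uT: "u (T x) = x" if "a < x" "x < b" for x
    using T_dec[of x "u (T x)"] T_dec[of "u (T x)" x] u[of "T x"] that
    by (metis less_irrefl linorder_neqE)
  have u_dec: "u t < u s" if "s < t" for s t
    using T_dec[of "u s" "u t"] u[of s] u[of t] that by (metis less_asym linorder_neqE)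
  show thesis
  proof
    show "a < u \<xi>" "u \<xi> < b" for \<xi> using u by auto
    show "(u has_real_derivative F (u \<xi>)) (at \<xi>)" for \<xi>
    proof -
      have "(u has_derivative (*) (F (u \<xi>))) (at (T (u \<xi>)))"
      proof (rule has_derivative_inverse_strong[where f = T and f' = "(*) (1 / F (u \<xi>))"])
        show "(T has_derivative (*) (1 / F (u \<xi>))) (at (u \<xi>))"
          using T[OF u(1,2)] by (simp add: has_field_derivative_def)
        show "(*) (1 / F (u \<xi>)) \<circ> (*) (F (u \<xi>)) = id"
          using neg[OF u(1,2)[of \<xi>]] by auto
        show "open {a<..<b}" "u \<xi> \<in> {a<..<b}" using u by auto
        show "continuous_on {a<..<b} T"
          using DERIV_isCont[OF T] by (auto intro!: continuous_at_imp_continuous_on)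
        show "u (T z) = z" if "z \<in> {a<..<b}" for z using uT that by auto
      qed
      then show ?thesis using u(3) by (simp add: has_field_derivative_def)
    qed
    show "u \<eta> < u \<xi>" if "\<xi> < \<eta>" for \<xi> \<eta> using u_dec that .
    show "(u \<longlongrightarrow> b) at_bot"
    proof (rule order_tendstoI)
      fix y assume "y < b"
      define z where "z = max y m"
      have z: "a < z" "z < b" "y \<le> z" using m \<open>y < b\<close> by (auto simp: z_def)
      have "y < u t" if "t < T z" for t using u_dec[OF that] uT[OF z(1,2)] z by simp
      then show "eventually (\<lambda>t. y < u t) at_bot"
        using eventually_gt_at_bot by (rule eventually_mono[rotated]) (simp add: eventually_gt_at_bot)
    next
      fix y assume "b < y"
      then show "eventually (\<lambda>t. u t < y) at_bot" 
        by (intro always_eventually) (use u less_trans in blast)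
    qed
    show "(u \<longlongrightarrow> a) at_top"
    proof (rule order_tendstoI)
      fix y assume "a < y"
      define z where "z = min y m"
      have z: "a < z" "z < b" "z \<le> y" using m \<open>a < y\<close> by (auto simp: z_def)
      have "u t < y" if "T z < t" for t using u_dec[OF that] uT[OF z(1,2)] z by simp
      then show "eventually (\<lambda>t. u t < y) at_top"
        using eventually_gt_at_top by (rule eventually_mono[rotated]) 
    next
      fix y assume "y < a"
      then show "eventually (\<lambda>t. y < u t) at_top" 
        by (intro always_eventually) (use u less_trans in blast)
    qed
  qed
qed

section \<open>Smooth functions of one variable\<close>

lemma smooth_on_has_deriv_dir:
  fixes f :: "real \<Rightarrow> real"
  assumes "smooth_on S f" "x \<in> S"
  shows "(f has_real_derivative deriv_dir S 1 f x) (at x within S)"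
proof -
  have "Ck_on (Suc 0) S f" using assms by (simp add: smooth_on_def)
  then have "f differentiable (at x within S)"
    using assms(2) by (simp add: differentiable_on_def)
  then have D: "(f has_derivative frechet_derivative f (at x within S)) (at x within S)"
    by (simp add: frechet_derivative_works)
  then interpret bounded_linear "frechet_derivative f (at x within S)"
    by (rule has_derivative_bounded_linear)
  have "frechet_derivative f (at x within S) = (*) (deriv_dir S 1 f x)"
  proof
    fix t show "frechet_derivative f (at x within S) t = deriv_dir S 1 f x * t"
      using scaleR[of t 1] by (simp add: deriv_dir_def)
  qed
  with D show ?thesis by (simp add: has_field_derivative_def)
qed

lemma smooth_on_imp_continuous_on:
  fixes f :: "real \<Rightarrow> real"
  assumes "smooth_on S f"
  shows "continuous_on S f"
proof -
  have "Ck_on 0 S f" using assms unfolding smooth_on_def ..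
  then show ?thesis by simp
qed

lemma smooth_on_Lipschitz_on_interval:
  fixes f :: "real \<Rightarrow> real"
  assumes f: "smooth_on S f" and sub: "{a..b} \<subseteq> S"
  obtains K where "K > 0" "\<And>x y. x \<in> {a..b} \<Longrightarrow> y \<in> {a..b} \<Longrightarrow> \<bar>f x - f y\<bar> \<le> K * \<bar>x - y\<bar>"
proof -
  have "Ck_on (Suc 0) S f" using f by (simp add: smooth_on_def)
  then have "continuous_on {a..b} (deriv_dir S 1 f)"
    using sub by (auto intro: continuous_on_subset)
  then have "bounded (deriv_dir S 1 f ` {a..b})"
    by (intro compact_imp_bounded compact_continuous_image) auto
  then obtain K where K: "K > 0" "\<And>x. x \<in> {a..b} \<Longrightarrow> \<bar>deriv_dir S 1 f x\<bar> \<le> K"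
    by (auto simp: bounded_pos)
  have "norm (f x - f y) \<le> K * norm (x - y)" if "x \<in> {a..b}" "y \<in> {a..b}" for x y
  proof (rule field_differentiable_bound[OF _ _ _ that(1,2)])
    show "(f has_field_derivative deriv_dir S 1 f z) (at z within {a..b})" if "z \<in> {a..b}" for z
      using smooth_on_has_deriv_dir[OF f, of z] that sub by (blast intro: DERIV_subset)
  qed (use K in auto)
  then show thesis using K(1) that by auto
qed

text \<open>
  The switch of the hysteresis may put a kink into \<open>h\<close>, so the chain rule does not give its
  derivative at every point of differentiability. The following comparison does not use the chain
  rule, and it yields \<open>h' \<longlongrightarrow> 0\<close> from \<open>u' \<longlongrightarrow> 0\<close>.
\<close>

lemma deriv_bound_of_increment_bound:
  fixes f g :: "real \<Rightarrow> real"
  assumes f: "(f has_real_derivative f') (at x)" and g: "(g has_real_derivative g') (at x)"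
    and le: "\<And>y. \<bar>f y - f x\<bar> \<le> K * \<bar>g y - g x\<bar>"
  shows "\<bar>f'\<bar> \<le> K * \<bar>g'\<bar>"
proof (rule tendsto_le)
  show "((\<lambda>y. \<bar>(f y - f x) / (y - x)\<bar>) \<longlongrightarrow> \<bar>f'\<bar>) (at x)"
    using f by (intro tendsto_rabs) (simp add: has_field_derivative_iff)
  show "((\<lambda>y. K * \<bar>(g y - g x) / (y - x)\<bar>) \<longlongrightarrow> K * \<bar>g'\<bar>) (at x)"
    using g by (intro tendsto_mult tendsto_const tendsto_rabs) (simp add: has_field_derivative_iff)
  show "\<forall>\<^sub>F y in at x. \<bar>(f y - f x) / (y - x)\<bar> \<le> K * \<bar>(g y - g x) / (y - x)\<bar>"
  proof (intro always_eventually allI)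
    fix y
    have "\<bar>f y - f x\<bar> / \<bar>y - x\<bar> \<le> K * \<bar>g y - g x\<bar> / \<bar>y - x\<bar>"
      by (intro divide_right_mono le) simp
    then show "\<bar>(f y - f x) / (y - x)\<bar> \<le> K * \<bar>(g y - g x) / (y - x)\<bar>"
      by (simp add: abs_divide)
  qed
qed simp

section \<open>The deceleration curve and the velocity at a fixed hysteresis parameter\<close>

context hysteresis_model
begin

abbreviation hD :: "real \<Rightarrow> real" where "hD \<equiv> inv_curve uD"

lemma uD_ge_1: "1 \<le> h \<Longrightarrow> 1 \<le> uD h"
  using bij_betw_apply[OF uD_bij, of h] by simp

lemma uD_less_iff: "1 \<le> h \<Longrightarrow> 1 \<le> k \<Longrightarrow> uD h < uD k \<longleftrightarrow> h < k"
  using strict_mono_on_less[OF uD_mono, of h k] by simp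

lemma hD_ge_1: "1 \<le> u \<Longrightarrow> 1 \<le> hD u"
  using bij_betw_apply[OF bij_betw_inv_into[OF uD_bij], of u] by simp

lemma uD_hD: "1 \<le> u \<Longrightarrow> uD (hD u) = u"
  using bij_betw_inv_into_right[OF uD_bij, of u] by simp

lemma hD_uD: "1 \<le> h \<Longrightarrow> hD (uD h) = h"
  using bij_betw_inv_into_left[OF uD_bij, of h] by simp

lemma hD_less_iff: "1 \<le> u \<Longrightarrow> 1 \<le> h \<Longrightarrow> hD u < h \<longleftrightarrow> u < uD h"
  using uD_less_iff[of "hD u" h] by (simp add: hD_ge_1 uD_hD)

lemma hD_has_derivative:
  assumes "1 < u"
  shows "(hD has_real_derivative deriv_dir {1..} 1 hD u) (at u)"
proof -
  have "at u within {1..} = at u"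
    by (rule at_within_open_subset[of _ "{1<..}"]) (use assms in auto)
  then show ?thesis using smooth_on_has_deriv_dir[OF hD_smooth, of u] assms by simp
qed

lemma vD_strict_mono:
  assumes "1 \<le> x" "x < y"
  shows "vD x < vD y"
proof -
  have "\<exists>z\<in>{x<..<y}. vD y - vD x = (\<lambda>t. t * deriv_dir {1..} 1 vD z) (y - x)"
  proof (rule mvt_simple[OF assms(2)])
    show "(vD has_derivative (\<lambda>t. t * deriv_dir {1..} 1 vD z)) (at z within {x..y})"
      if "x \<le> z" "z \<le> y" for z
      using DERIV_subset[OF smooth_on_has_deriv_dir[OF vD_smooth, of z], of "{x..y}"] that assms
      by (simp add: has_field_derivative_def mult_commute_abs)
  qed
  then obtain z where z: "x < z" "vD y - vD x = (y - x) * deriv_dir {1..} 1 vD z" by auto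
  have "(y - x) * deriv_dir {1..} 1 vD z > 0" using vD_u[of z] z assms by simp
  then show ?thesis using z by linarith
qed

text \<open>
  The partial derivative in the model is taken within a planar region; composing with the
  embedding of a horizontal slice turns it into an ordinary one-sided derivative.
\<close>

lemma vS_slice_deriv:
  assumes "h \<noteq> hc" "1 \<le> h" "uD h \<le> u" "u \<le> uA h"
  shows "((\<lambda>u. vS u h) has_real_derivative
           deriv_dir (Omega uA uD - {(uc, hc)}) (1, 0) (\<lambda>(u, h). vS u h) (u, h))
         (at u within {uD h..uA h})"
proof -
  define S where "S = Omega uA uD - {(uc, hc)}"
  define f where "f = (\<lambda>(u, h). vS u h)"
  have slice: "(\<lambda>u. (u, h)) ` {uD h..uA h} \<subseteq> S"
    using assms uD_ge_1[of h] by (auto simp: S_def Omega_def)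
  have "Ck_on (Suc 0) S f" using vS_smooth by (simp add: smooth_on_def S_def f_def)
  moreover have "(u, h) \<in> S" using slice assms by auto
  ultimately have "f differentiable (at (u, h) within S)"
    by (simp add: differentiable_on_def)
  then have D: "(f has_derivative frechet_derivative f (at (u, h) within S)) (at (u, h) within S)"
    by (simp add: frechet_derivative_works)
  then interpret bounded_linear "frechet_derivative f (at (u, h) within S)"
    by (rule has_derivative_bounded_linear)
  have "((\<lambda>u. f (u, h)) has_derivative (\<lambda>t. frechet_derivative f (at (u, h) within S) (t, 0)))
      (at u within {uD h..uA h})"
    by (rule has_derivative_in_compose2[OF _ slice, of f
          "\<lambda>p. frechet_derivative f (at p within S)" u "\<lambda>t. (t, 0)"])
      (use assms \<open>Ck_on (Suc 0) S f\<close> in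
        \<open>auto intro!: derivative_eq_intros simp: differentiable_on_def frechet_derivative_works[symmetric]\<close>)
  moreover have "frechet_derivative f (at (u, h) within S) (t, 0) = deriv_dir S (1, 0) f (u, h) * t" for t
    using scaleR[of t "(1, 0)"] by (simp add: deriv_dir_def)
  ultimately show ?thesis
    unfolding S_def[symmetric] f_def[symmetric] by (simp add: has_field_derivative_def f_def)
qed

lemma vS_strict_mono:
  assumes "1 \<le> h" "uD h \<le> x" "x < y" "y \<le> uA h"
  shows "vS x h < vS y h"
proof -
  let ?d = "\<lambda>z. deriv_dir (Omega uA uD - {(uc, hc)}) (1, 0) (\<lambda>(u, h). vS u h) (z, h)"
  have h: "h \<noteq> hc" using assms uA_eq_uD[of h] by auto
  have "\<exists>z\<in>{x<..<y}. vS y h - vS x h = (\<lambda>t. t * ?d z) (y - x)"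
  proof (rule mvt_simple[OF assms(3)])
    show "((\<lambda>u. vS u h) has_derivative (\<lambda>t. t * ?d z)) (at z within {x..y})"
      if "x \<le> z" "z \<le> y" for z
      using DERIV_subset[OF vS_slice_deriv[OF h, of z], of "{x..y}"] that assms
      by (simp add: has_field_derivative_def mult_commute_abs)
  qed
  then obtain z where z: "x < z" "z < y" "vS y h - vS x h = (y - x) * ?d z" by auto
  have "?d z > 0"
    by (rule vS_u) (use z assms h uD_ge_1[of h] in \<open>auto simp: Omega_def\<close>)
  then have "(y - x) * ?d z > 0" using assms by simp
  then show ?thesis using z by linarith
qed

lemma velocity_left: "u \<le> uD h \<Longrightarrow> velocity vA vD vS uA uD u h = vD u"
  by (simp add: velocity_def)

lemma velocity_scanning:
  assumes "1 \<le> h" "uD h \<le> u" "u \<le> uA h"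
  shows "velocity vA vD vS uA uD u h = vS u h"
  using assms vS_on_A[of h] vS_on_D[of h] by (auto simp: velocity_def)

text \<open>
  The bound \<open>y \<le> uA h\<close> confines the argument to the deceleration and scanning branches, which agree
  at \<open>uD h\<close>.
\<close>

lemma velocity_strict_mono:
  assumes "1 \<le> h" "1 \<le> x" "x < y" "y \<le> uA h"
  shows "velocity vA vD vS uA uD x h < velocity vA vD vS uA uD y h"
proof -
  consider "y \<le> uD h" | "uD h \<le> x" | "x < uD h" "uD h < y" by linarith
  then show ?thesis
  proof cases
    case 1
    then show ?thesis using vD_strict_mono[of x y] assms by (simp add: velocity_left)
  next
    case 2
    then show ?thesis using vS_strict_mono[of h x y] assms by (simp add: velocity_scanning)
  next
    case 3
    then show ?thesis
      using vD_strict_mono[of x "uD h"] vS_strict_mono[of h "uD h" y] vS_on_D[of h] assms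
      by (simp add: velocity_left velocity_scanning)
  qed
qed

lemma velocity_continuous_on:
  assumes "1 \<le> h"
  shows "continuous_on {1..uA h} (\<lambda>u. velocity vA vD vS uA uD u h)"
proof -
  have "continuous_on ({1..uD h} \<union> {uD h..uA h}) (\<lambda>u. velocity vA vD vS uA uD u h)"
  proof (rule continuous_on_closed_Un)
    have "continuous_on {1..uD h} vD"
      by (rule continuous_on_subset[OF smooth_on_imp_continuous_on[OF vD_smooth]]) auto
    then show "continuous_on {1..uD h} (\<lambda>u. velocity vA vD vS uA uD u h)"
      by (rule continuous_on_eq) (simp add: velocity_left)
    have "continuous_on {uD h..uA h} (\<lambda>u. (\<lambda>(u, h). vS u h) (u, h))"
     
      by (rule continuous_on_compose2[OF vS_cont])
        (use assms uD_ge_1[of h] in \<open>auto intro!: continuous_intros simp: Omega_def\<close>)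
    then show "continuous_on {uD h..uA h} (\<lambda>u. velocity vA vD vS uA uD u h)"
      by (rule continuous_on_eq) (use assms in \<open>simp add: velocity_scanning\<close>)
  qed auto
  moreover have "{1..uD h} \<union> {uD h..uA h} = {1..uA h}"
    using assms uD_ge_1[of h] uA_ge_uD[of h] by auto
  ultimately show ?thesis by simp
qed

section \<open>The viscous profile\<close>

lemma viscous_profile_along_uD:
  fixes um hm hp
  defines "v \<equiv> velocity vA vD vS uA uD"
  defines "up \<equiv> uD hp"
  defines "s \<equiv> shock_speed v um hm up hp"
  assumes left_state: "(um, hm) \<in> Omega uA uD"
    and h_order: "hm > hp" "hp \<ge> 1"
    and chord: "\<And>u. u \<in> {up<..<um} \<Longrightarrow>
          (v up hp - v um hm) / (up - um) > (v u hm - v um hm) / (u - um)"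
  shows "\<exists>u h. viscous_profile v uA uD s um hm up hp u h"
proof -
  define G where "G u = v u hm" for u
  define c where "c = - s"
  define F where "F u = c * (u - um) - (G u - G um)" for u
  have hm: "1 \<le> hm" and um: "uD hm \<le> um" "um \<le> uA hm"
    using left_state by (auto simp: Omega_def)
  have up: "1 \<le> up" "up < uD hm" "up < um"
    using h_order hm um uD_less_iff[of hp hm] uD_ge_1[of hp] by (auto simp: up_def)
  have vp: "v up hp = G up" 
    using up by (simp add: G_def v_def velocity_left) (simp add: up_def velocity_left)
  have G_less: "G x < G y" if "1 \<le> x" "x < y" "y \<le> um" for x y
    using velocity_strict_mono[of hm x y] that hm um by (simp add: G_def v_def)
  have c_eq: "c = (G um - G up) / (um - up)"
    using up by (simp add: c_def s_def shock_speed_def vp G_def[symmetric] field_simps)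
  have c_pos: "c > 0" using G_less[of up um] up by (simp add: c_eq)
  have c_chord: "c * (um - up) = G um - G up" using up by (simp add: c_eq)
  have F_neg: "F u < 0" if "up < u" "u < um" for u
  proof -
    have "c > (G u - G um) / (u - um)"
      using chord[of u] that by (simp add: c_def s_def shock_speed_def G_def del: minus_diff_eq)
    then show ?thesis using that by (simp add: F_def neg_divide_less_eq)
  qed
  have F_cont: "continuous_on {up..um} F"
    unfolding F_def G_def v_def
    by (intro continuous_intros continuous_on_subset[OF velocity_continuous_on[OF hm]])
      (use up um in auto)
  have F_um: "F um = 0" and F_up: "F up = 0"
    using c_chord by (simp_all add: F_def algebra_simps)
  have F_um_bound: "- F u \<le> c * (um - u)" if "up < u" "u < um" for u
    using G_less[of u um] that up by (simp add: F_def algebra_simps)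
  obtain K where K: "K > 0" "\<And>x y. x \<in> {up..um} \<Longrightarrow> y \<in> {up..um} \<Longrightarrow> \<bar>vD x - vD y\<bar> \<le> K * \<bar>x - y\<bar>"
    by (rule smooth_on_Lipschitz_on_interval[OF vD_smooth, of up um]) (use up in auto)
  \<comment> \<open>\<open>K\<close> controls \<open>G u - G up\<close> on the deceleration branch. Beyond \<open>uD hm\<close> the distance \<open>u - up\<close>
    is bounded away from \<open>0\<close>, so the total increment of \<open>G\<close> over \<open>uD hm - up\<close> suffices as a slope.\<close>
  define L where "L = K + (G um - G up) / (uD hm - up)"
  have q_pos: "(G um - G up) / (uD hm - up) > 0" using G_less[of up um] up by simp
  have L_pos: "L > 0" using K q_pos by (simp add: L_def)
  have F_up_bound: "- F u \<le> L * (u - up)" if u: "up < u" "u < um" for u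
  proof -
    have "- F u = G u - G up - c * (u - up)"
      using c_chord by (simp add: F_def algebra_simps)
    also have "\<dots> \<le> G u - G up" using c_pos u by simp
    also have "\<dots> \<le> L * (u - up)"
    proof (cases "u \<le> uD hm")
      case True
      then have "G u - G up \<le> K * (u - up)"
        using K(2)[of u up] u up by (simp add: G_def v_def velocity_left)
      also have "\<dots> \<le> L * (u - up)"
        using q_pos u by (intro mult_right_mono) (auto simp: L_def)
      finally show ?thesis .
    next
      case False
      have "G u - G up \<le> (G um - G up) / (uD hm - up) * (uD hm - up)"
        using G_less[of u um] u up by simp
      also have "\<dots> \<le> L * (u - up)"
        using K(1) q_pos L_pos False up by (intro mult_mono) (auto simp: L_def)
      finally show ?thesis .
    qed
    finally show ?thesis .
  qed
  obtain u where u: "\<And>\<xi>. up < u \<xi>" "\<And>\<xi>. u \<xi> < um"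
    and u_deriv: "\<And>\<xi>. (u has_real_derivative F (u \<xi>)) (at \<xi>)"
    and u_dec: "\<And>\<xi> \<eta>. \<xi> < \<eta> \<Longrightarrow> u \<eta> < u \<xi>"
    and u_bot: "(u \<longlongrightarrow> um) at_bot" and u_top: "(u \<longlongrightarrow> up) at_top"
    by (rule decreasing_heteroclinic_orbit[of up um F L c])
      (use up F_neg L_pos F_up_bound c_pos F_um_bound in
        \<open>auto intro: continuous_on_subset[OF F_cont]\<close>)
  have u1: "1 < u \<xi>" for \<xi> using u(1)[of \<xi>] up by simp
  have u_cont: "continuous_on UNIV u"
    using DERIV_isCont[OF u_deriv] by (auto intro!: continuous_at_imp_continuous_on)
  have deriv_u: "deriv u \<xi> = F (u \<xi>)" for \<xi> using u_deriv by (rule DERIV_imp_deriv)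

  define h where "h \<xi> = min hm (hD (u \<xi>))" for \<xi>
  have h_right: "h \<xi> = hm" if "uD hm \<le> u \<xi>" for \<xi>
    using hD_less_iff[of "u \<xi>" hm] u1[of \<xi>] hm that by (simp add: h_def)
  have h_left: "h \<xi> = hD (u \<xi>)" if "u \<xi> \<le> uD hm" for \<xi>
    using hD_less_iff[of "u \<xi>" hm] u1[of \<xi>] hm that hD_uD[of hm] by (auto simp: h_def min_def not_less)
  \<comment> \<open>The decoupling: the velocity along the profile is the one at \<open>h = hm\<close>.\<close>
  have v_eq: "v (u \<xi>) (h \<xi>) = G (u \<xi>)" for \<xi>
  proof (cases "u \<xi> \<le> uD hm")
    case True
    then show ?thesis using u1[of \<xi>] by (simp add: h_left G_def v_def velocity_left uD_hD)
  qed (simp add: h_right G_def)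
  obtain K' where K': "K' > 0" "\<And>x y. x \<in> {up..um} \<Longrightarrow> y \<in> {up..um} \<Longrightarrow> \<bar>hD x - hD y\<bar> \<le> K' * \<bar>x - y\<bar>"
    by (rule smooth_on_Lipschitz_on_interval[OF hD_smooth, of up um]) (use up in auto)
  have h_incr: "\<bar>h \<eta> - h \<xi>\<bar> \<le> K' * \<bar>u \<eta> - u \<xi>\<bar>" for \<xi> \<eta>
  proof -
    have "\<bar>h \<eta> - h \<xi>\<bar> \<le> \<bar>hD (u \<eta>) - hD (u \<xi>)\<bar>" by (auto simp: h_def min_def)
    also have "\<dots> \<le> K' * \<bar>u \<eta> - u \<xi>\<bar>"
      using u[of \<xi>] u[of \<eta>] by (intro K'(2)) auto
    finally show ?thesis .
  qed
  have "bounded (F ` {up..um})"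
    by (intro compact_imp_bounded compact_continuous_image F_cont) auto
  then obtain B where B: "B > 0" "\<And>x. x \<in> {up..um} \<Longrightarrow> \<bar>F x\<bar> \<le> B"
    by (auto simp: bounded_pos)
  have u_lip: "\<bar>u \<eta> - u \<xi>\<bar> \<le> B * \<bar>\<eta> - \<xi>\<bar>" for \<xi> \<eta>
    using field_differentiable_bound[of UNIV u "\<lambda>\<xi>. F (u \<xi>)" B \<eta> \<xi>] u_deriv B(2) u
    by (auto simp: less_imp_le)
  have h_lip: "(K' * B)-lipschitz_on S h" for S
  proof (rule lipschitz_onI)
    fix \<xi> \<eta>
    have "\<bar>h \<xi> - h \<eta>\<bar> \<le> K' * \<bar>u \<xi> - u \<eta>\<bar>" by (rule h_incr)
    also have "\<dots> \<le> K' * (B * \<bar>\<xi> - \<eta>\<bar>)" using K'(1) u_lip by (intro mult_left_mono) auto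
    finally show "dist (h \<xi>) (h \<eta>) \<le> K' * B * dist \<xi> \<eta>" by (simp add: dist_real_def mult.assoc)
  qed (use K' B in simp)
  have hD_lim: "((\<lambda>\<xi>. hD (u \<xi>)) \<longlongrightarrow> hD x) Flt" if "(u \<longlongrightarrow> x) Flt" "1 \<le> x" for x Flt
    by (rule continuous_on_tendsto_compose[OF smooth_on_imp_continuous_on[OF hD_smooth] that(1)])
      (use that u1 in \<open>auto intro!: always_eventually less_imp_le\<close>)
  have F_lim: "((\<lambda>\<xi>. F (u \<xi>)) \<longlongrightarrow> F x) Flt" if "(u \<longlongrightarrow> x) Flt" "x \<in> {up..um}" for x Flt
    by (rule continuous_on_tendsto_compose[OF F_cont that])
      (use u in \<open>auto intro!: always_eventually less_imp_le\<close>)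
  have du_bot: "(deriv u \<longlongrightarrow> 0) at_bot" and du_top: "(deriv u \<longlongrightarrow> 0) at_top"
    using F_lim[OF u_bot] F_lim[OF u_top] up F_um F_up by (simp_all add: deriv_u[abs_def])
  have dh: "(deriv h \<longlongrightarrow> 0) (inf Flt (principal {\<xi>. h differentiable (at \<xi>)}))"
    if "(deriv u \<longlongrightarrow> 0) Flt" for Flt
  proof (rule Lim_null_comparison)
    have "\<bar>deriv h \<xi>\<bar> \<le> K' * \<bar>deriv u \<xi>\<bar>" if "h differentiable (at \<xi>)" for \<xi>
    proof (rule deriv_bound_of_increment_bound)
      show "(h has_real_derivative deriv h \<xi>) (at \<xi>)"
        using that by (simp add: DERIV_deriv_iff_real_differentiable)
      show "(u has_real_derivative deriv u \<xi>) (at \<xi>)" using u_deriv by (simp add: deriv_u)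
    qed (rule h_incr)
    then show "\<forall>\<^sub>F \<xi> in inf Flt (principal {\<xi>. h differentiable (at \<xi>)}).
        norm (deriv h \<xi>) \<le> K' * \<bar>deriv u \<xi>\<bar>"
      by (simp add: eventually_inf_principal always_eventually)
    have "((\<lambda>\<xi>. K' * \<bar>deriv u \<xi>\<bar>) \<longlongrightarrow> K' * \<bar>0\<bar>) Flt"
      using that by (intro tendsto_intros)
    then show "((\<lambda>\<xi>. K' * \<bar>deriv u \<xi>\<bar>) \<longlongrightarrow> 0) (inf Flt (principal {\<xi>. h differentiable (at \<xi>)}))"
      using tendsto_mono[OF inf_le1] by fastforce
  qed
  have h_bot: "(h \<longlongrightarrow> hm) at_bot"
  proof -
    have "(h \<longlongrightarrow> min hm (hD um)) at_bot"
      unfolding h_def[abs_def] using up by (intro tendsto_min tendsto_const hD_lim u_bot) simp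
    moreover have "min hm (hD um) = hm" using hD_less_iff[of um hm] um up hm by simp
    ultimately show ?thesis by simp
  qed
  have h_top: "(h \<longlongrightarrow> hp) at_top"
  proof -
    have "(h \<longlongrightarrow> min hm (hD up)) at_top"
      unfolding h_def[abs_def] using up by (intro tendsto_min tendsto_const hD_lim u_top) simp
    moreover have "min hm (hD up) = hp" using h_order by (simp add: up_def hD_uD)
    ultimately show ?thesis by simp
  qed
  have ode_h: "\<exists>h' a d. (h has_real_derivative h') (at \<xi>) \<and>
         (s * deriv u \<xi> < 0 \<and> u \<xi> = uA (h \<xi>)
            \<longrightarrow> ((\<lambda>\<eta>. hA (u \<eta>)) has_real_derivative a) (at \<xi>)) \<and>
         (s * deriv u \<xi> > 0 \<and> u \<xi> = uD (h \<xi>)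
            \<longrightarrow> ((\<lambda>\<eta>. hD (u \<eta>)) has_real_derivative d) (at \<xi>)) \<and>
         s * h' = s * of_bool (s * deriv u \<xi> < 0 \<and> u \<xi> = uA (h \<xi>)) * a
           + s * of_bool (s * deriv u \<xi> > 0 \<and> u \<xi> = uD (h \<xi>)) * d"
    if \<xi>: "u \<xi> \<noteq> uD hm" for \<xi> and hA :: "real \<Rightarrow> real"
  proof -
    \<comment> \<open>The sign that excludes the acceleration branch and activates the deceleration branch.\<close>
    have su: "s * deriv u \<xi> > 0"
      using c_pos F_neg[OF u] by (simp add: deriv_u c_def mult_neg_neg)
    have open_right: "\<forall>\<^sub>F \<eta> in nhds \<xi>. u \<eta> > uD hm" if "u \<xi> > uD hm"
      using that DERIV_isCont[OF u_deriv] by (auto simp: isCont_def tendsto_at_iff_tendsto_nhds intro: order_tendstoD)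
    have open_left: "\<forall>\<^sub>F \<eta> in nhds \<xi>. u \<eta> < uD hm" if "u \<xi> < uD hm"
      using that DERIV_isCont[OF u_deriv] by (auto simp: isCont_def tendsto_at_iff_tendsto_nhds intro: order_tendstoD)
    show ?thesis
    proof (cases "u \<xi> > uD hm")
      case True
      have "\<forall>\<^sub>F \<eta> in nhds \<xi>. h \<eta> = hm"
        using open_right[OF True] by (rule eventually_mono) (simp add: h_right)
      then have "(h has_real_derivative 0) (at \<xi>) \<longleftrightarrow> ((\<lambda>_. hm) has_real_derivative 0) (at \<xi>)"
        by (intro DERIV_cong_ev) auto
      then show ?thesis using su True h_right[of \<xi>]
        by (intro exI[of _ 0]) auto
    next
      case False
      then have less: "u \<xi> < uD hm" using \<xi> by simp
      have D: "((\<lambda>\<eta>. hD (u \<eta>)) has_real_derivative deriv_dir {1..} 1 hD (u \<xi>) * F (u \<xi>)) (at \<xi>)"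
        using DERIV_chain2[OF hD_has_derivative[OF u1] u_deriv] .
      have "\<forall>\<^sub>F \<eta> in nhds \<xi>. h \<eta> = hD (u \<eta>)"
        using open_left[OF less] by (rule eventually_mono) (simp add: h_left)
      then have "(h has_real_derivative d) (at \<xi>) \<longleftrightarrow> ((\<lambda>\<eta>. hD (u \<eta>)) has_real_derivative d) (at \<xi>)" for d
        by (intro DERIV_cong_ev) auto
      moreover have "u \<xi> = uD (h \<xi>)" using less u1[of \<xi>] by (simp add: h_left uD_hD)
      ultimately show ?thesis using su D
        by (intro exI[of _ "deriv_dir {1..} 1 hD (u \<xi>) * F (u \<xi>)"] exI[of _ 0]) auto
    qed
  qed
  have switch_AE: "AE \<xi> in lborel. u \<xi> \<noteq> uD hm"
  proof -
    have "inj u" using u_dec by (metis injI less_irrefl linorder_neqE)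
    then have "finite {\<xi>. u \<xi> = uD hm}"
      using finite_vimageI[of "{uD hm}" u] by (simp add: vimage_def)
    then have "{\<xi>. u \<xi> = uD hm} \<in> null_sets lborel" by (rule finite_imp_null_set_lborel)
    then show ?thesis by (rule AE_I') auto
  qed
  have ode_u: "(u has_real_derivative - s * (u \<xi> - um) - (v (u \<xi>) (h \<xi>) - v um hm)) (at \<xi>)"
    "(u has_real_derivative - s * (u \<xi> - up) - (v (u \<xi>) (h \<xi>) - v up hp)) (at \<xi>)" for \<xi>
  proof -
    have "- s * (u \<xi> - um) - (v (u \<xi>) (h \<xi>) - v um hm) = F (u \<xi>)"
      by (simp add: v_eq F_def c_def G_def)
    moreover have "- s * (u \<xi> - up) - (v (u \<xi>) (h \<xi>) - v up hp) = F (u \<xi>)"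
      using c_chord by (simp add: v_eq vp F_def c_def algebra_simps)
    ultimately show "(u has_real_derivative - s * (u \<xi> - um) - (v (u \<xi>) (h \<xi>) - v um hm)) (at \<xi>)"
      "(u has_real_derivative - s * (u \<xi> - up) - (v (u \<xi>) (h \<xi>) - v up hp)) (at \<xi>)"
      using u_deriv by simp_all
  qed
  have "viscous_profile v uA uD s um hm up hp u h"
    unfolding viscous_profile_def Let_def
  proof (intro conjI allI)
    show "1 \<le> u \<xi>" "1 \<le> h \<xi>" for \<xi>
      using u1[of \<xi>] hm by (auto simp: h_def hD_ge_1)
    show "continuous_on UNIV h" using h_lip by (rule lipschitz_on_continuous_on)
    show "\<exists>e>0. \<exists>L. L-lipschitz_on (cball \<xi> e) h" for \<xi>
      using h_lip zero_less_one by blast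
  qed (rule u_cont ode_u u_bot u_top h_bot h_top du_bot du_top dh[OF du_bot] dh[OF du_top]
      | (rule eventually_mono[OF switch_AE], rule ode_h, assumption))+
  then show ?thesis by blast
qed

end

theorem theorem4p6:
  fixes vA vD uA uD :: "real \<Rightarrow> real" and vS v :: "real \<Rightarrow> real \<Rightarrow> real"
    and u0A uc hc um hm up hp :: real
  assumes model: "hysteresis_model vA vD vS uA uD u0A uc hc"
    and v_def: "v = velocity vA vD vS uA uD"
    and left_state: "(um, hm) \<in> Omega uA uD"
    and h_order: "hm > hp" "hp \<ge> 1"
    and right_state: "up = uD hp"
    and chord: "\<And>u. u \<in> {up<..<um} \<Longrightarrow>
          (v up hp - v um hm) / (up - um) > (v u hm - v um hm) / (u - um)"
  shows "\<exists>W. shock_wave v uA uD um hm up hp W"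
proof -
  interpret hysteresis_model vA vD vS uA uD u0A uc hc by (rule model)
  let ?s = "shock_speed v um hm up hp"
  have "\<exists>u h. viscous_profile v uA uD ?s um hm up hp u h"
    using viscous_profile_along_uD[of um hm hp] left_state h_order chord
    by (simp add: v_def right_state)
  moreover have "1 \<le> up" "1 \<le> um" "1 \<le> hm" "um \<noteq> up"
    using left_state h_order uD_less_iff[of hp hm] uD_ge_1[of hp]
    by (auto simp: Omega_def right_state)
  ultimately show ?thesis
    using h_order
    by (intro exI[of _ "\<lambda>t x. if x < ?s * t then (um, hm) else (up, hp)"])
      (simp add: shock_wave_def Let_def)
qed

end
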